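(* The hydrostatic reconstruction scheme (with any consistent numerical flux $\mathbf f^*$) applied to the shallow water equations preserves the lake-at-rest initial condition $h\,\partial_x(h+b)=0$, $v=0$; that is, for every discrete lake-at-rest state the scheme gives $\frac{d}{dt}\mathbf u_i=0$ for all cells $i$.
   Context: Shallow water equations (gravity $g>0$, bottom $b(x)$): $\partial_t h+\partial_x(hv)=0$, $\partial_t(hv)+\partial_x(hv^2)=-gh\,\partial_x(h+b)$. Write $\mathbf u=(h,hv)^T$, $\mathbf f=(hv,hv^2)^T$, $\boldsymbol\phi=g(0,h)^T$, $\mathbf r=(0,h+b)^T$; $\circ$ is the Hadamard product. Grid and data: uniform one-dimensional cells (infinite or periodic grid) of size $\Delta x$ with constant values $b_i\in\mathbb R$, $h_i\ge0$, $v_i\in\mathbb R$; $H_i=h_i+b_i$. At interface $i+\frac12$, superscript $-$ denotes values of cell $i$, $+$ of cell $i+1$; $[\![a]\!]=a^+-a^-$. Hydrostatic reconstruction at each interface: $b_\epsilon^\pm=\min(H^\pm,\max(b^-,b^+))$, $H_\epsilon^\pm=\max(H^\pm,b_\epsilon^\pm)$, $h_\epsilon^\pm=H_\epsilon^\pm-b_\epsilon^\pm$, $\mathbf u_\epsilon^\pm=(h_\epsilon^\pm,h_\epsilon^\pm v^\pm)^T$; $\boldsymbol\phi_\epsilon^\pm,\mathbf r_\epsilon^\pm$ are $\boldsymbol\phi,\mathbf r$ evaluated with $h_\epsilon^\pm,b_\epsilon^\pm$. Hydrostatic reconstruction scheme: $$\Delta x\frac{d}{dt}\mathbf u_i=-\big(\mathbf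 f^*_{\epsilon,i+1/2}-\mathbf f^*_{\epsilon,i-1/2}\big)-\tfrac12\boldsymbol\phi^-_{\epsilon,i+1/2}\circ[\![\mathbf r_\epsilon]\!]_{i+1/2}-\tfrac12\boldsymbol\phi^+_{\epsilon,i-1/2}\circ[\![\mathbf r_\epsilon]\!]_{i-1/2},$$ where $\mathbf f^*_\epsilon$ is the numerical flux evaluated at the two reconstructed states $(h_\epsilon^-,v^-)$, $(h_\epsilon^+,v^+)$. Consistent means that the numerical flux of two identical states $(h,v)$ equals $\mathbf f=(hv,hv^2)^T$. Discrete lake-at-rest state: $v_i=0$ for all $i$, and at each interface there is a constant $C$ with $H^-=\max(C,b^-)$ and $H^+=\max(C,b^+)$ (constant surface level where wet; cells above that level are dry). *)

theory Defs
  imports "HOL-Analysis.Analysis"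
begin

text \<open>
  Cells are indexed by \<open>int\<close>, and the interface between the cells \<open>i\<close> and \<open>i + 1\<close> carries the
  index \<open>i\<close>. A periodic grid is the special case of periodic data.
  On \<open>real^2\<close> the product \<open>*\<close> is componentwise, i.e. the Hadamard product.
\<close>

type_synonym grid = "int \<Rightarrow> real"

definition conserved :: "real \<Rightarrow> real \<Rightarrow> real^2" where
  "conserved h v = vector [h, h * v]"

definition sw_flux :: "real \<Rightarrow> real \<Rightarrow> real^2" where
  "sw_flux h v = vector [h * v, h * v\<^sup>2]"

definition sw_phi :: "real \<Rightarrow> real \<Rightarrow> real^2" where
  "sw_phi g h = g *\<^sub>R vector [0, h]"

definition sw_r :: "real \<Rightarrow> real \<Rightarrow> real^2" where
  "sw_r h b = vector [0, h + b]"

text \<open>A numerical flux takes the left and right states as pairs \<open>(h, v)\<close>.\<close>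

type_synonym num_flux = "real \<times> real \<Rightarrow> real \<times> real \<Rightarrow> real^2"

definition consistent_flux :: "num_flux \<Rightarrow> bool" where
  "consistent_flux F \<longleftrightarrow> (\<forall>h v. h \<ge> 0 \<longrightarrow> F (h, v) (h, v) = sw_flux h v)"

definition b_eps_minus :: "grid \<Rightarrow> grid \<Rightarrow> grid" where
  "b_eps_minus b h i = min (h i + b i) (max (b i) (b (i + 1)))"

definition b_eps_plus :: "grid \<Rightarrow> grid \<Rightarrow> grid" where
  "b_eps_plus b h i = min (h (i + 1) + b (i + 1)) (max (b i) (b (i + 1)))"

definition H_eps_minus :: "grid \<Rightarrow> grid \<Rightarrow> grid" where
  "H_eps_minus b h i = max (h i + b i) (b_eps_minus b h i)"

definition H_eps_plus :: "grid \<Rightarrow> grid \<Rightarrow> grid" where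
  "H_eps_plus b h i = max (h (i + 1) + b (i + 1)) (b_eps_plus b h i)"

definition h_eps_minus :: "grid \<Rightarrow> grid \<Rightarrow> grid" where
  "h_eps_minus b h i = H_eps_minus b h i - b_eps_minus b h i"

definition h_eps_plus :: "grid \<Rightarrow> grid \<Rightarrow> grid" where
  "h_eps_plus b h i = H_eps_plus b h i - b_eps_plus b h i"

definition flux_eps :: "num_flux \<Rightarrow> grid \<Rightarrow> grid \<Rightarrow> grid \<Rightarrow> int \<Rightarrow> real^2" where
  "flux_eps F b h v i = F (h_eps_minus b h i, v i) (h_eps_plus b h i, v (i + 1))"

definition phi_eps_minus :: "real \<Rightarrow> grid \<Rightarrow> grid \<Rightarrow> int \<Rightarrow> real^2" where
  "phi_eps_minus g b h i = sw_phi g (h_eps_minus b h i)"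

definition phi_eps_plus :: "real \<Rightarrow> grid \<Rightarrow> grid \<Rightarrow> int \<Rightarrow> real^2" where
  "phi_eps_plus g b h i = sw_phi g (h_eps_plus b h i)"

definition jump_r_eps :: "grid \<Rightarrow> grid \<Rightarrow> int \<Rightarrow> real^2" where
  "jump_r_eps b h i =
     sw_r (h_eps_plus b h i) (b_eps_plus b h i) - sw_r (h_eps_minus b h i) (b_eps_minus b h i)"

text \<open>The time derivative of the conserved variables in cell \<open>i\<close> prescribed by the scheme, whose
  two interfaces have indices \<open>i\<close> (right) and \<open>i - 1\<close> (left).\<close>

definition hr_rate ::
    "real \<Rightarrow> real \<Rightarrow> num_flux \<Rightarrow> grid \<Rightarrow> grid \<Rightarrow> grid \<Rightarrow> int \<Rightarrow> real^2" where
  "hr_rate g dx F b h v i = (1 / dx) *\<^sub>R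
     (- (flux_eps F b h v i - flux_eps F b h v (i - 1))
      - (1/2) *\<^sub>R (phi_eps_minus g b h i * jump_r_eps b h i)
      - (1/2) *\<^sub>R (phi_eps_plus g b h (i - 1) * jump_r_eps b h (i - 1)))"

definition hr_solution ::
    "real \<Rightarrow> real \<Rightarrow> num_flux \<Rightarrow> grid \<Rightarrow> (real \<Rightarrow> grid) \<Rightarrow> (real \<Rightarrow> grid) \<Rightarrow> bool" where
  "hr_solution g dx F b h v \<longleftrightarrow>
     (\<forall>t\<ge>0. \<forall>i. h t i \<ge> 0 \<and>
        ((\<lambda>s. conserved (h s i) (v s i)) has_vector_derivative hr_rate g dx F b (h t) (v t) i)
          (at t within {0..}))"

text \<open>The constant \<open>C\<close> may differ from interface to interface, so wet regions separated by dry
  cells may have different surface levels.\<close>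

definition lake_at_rest :: "grid \<Rightarrow> grid \<Rightarrow> grid \<Rightarrow> bool" where
  "lake_at_rest b h v \<longleftrightarrow>
     (\<forall>i. v i = 0) \<and>
     (\<forall>i. \<exists>C. h i + b i = max C (b i) \<and> h (i + 1) + b (i + 1) = max C (b (i + 1)))"

end

theory Submission
  imports Defs
begin

text \<open>
  At a lake at rest with interface level \<open>C\<close>, both reconstructed depths equal
  \<open>max 0 (C - max b\<^sup>- b\<^sup>+)\<close> (lemma \<open>lake_reconstruction\<close>), and if this common depth is
  positive, both reconstructed surfaces are at \<open>C\<close>. Since the velocities vanish, the numerical flux
  sees two identical states at rest, so by consistency it is the exact flux, which is zero without
  a pressure term. In the source term either the depth in \<open>\<phi>\<close> or the jump of the surface is zero.
  Hence each term of the scheme vanishes separately, and the constant-in-time grid solves it.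
\<close>

lemma vector_2_eq_0_iff:
  fixes x y :: "'a::zero"
  shows "(vector [x, y] :: 'a^2) = 0 \<longleftrightarrow> x = 0 \<and> y = 0"
  by (simp add: vec_eq_iff forall_2)

lemma lake_reconstruction:
  assumes "h i + b i = max C (b i)" and "h (i + 1) + b (i + 1) = max C (b (i + 1))"
  shows "h_eps_minus b h i = max 0 (C - max (b i) (b (i + 1)))"
    and "h_eps_plus b h i = max 0 (C - max (b i) (b (i + 1)))"
    and "h_eps_minus b h i \<noteq> 0 \<Longrightarrow> h_eps_minus b h i + b_eps_minus b h i = C"
    and "h_eps_plus b h i \<noteq> 0 \<Longrightarrow> h_eps_plus b h i + b_eps_plus b h i = C"
  using assms
  unfolding h_eps_minus_def h_eps_plus_def H_eps_minus_def H_eps_plus_def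
    b_eps_minus_def b_eps_plus_def
  by (auto simp: max_def min_def split: if_splits)

lemma flux_eps_lake_at_rest:
  assumes "consistent_flux F" and "lake_at_rest b h v"
  shows "flux_eps F b h v i = 0"
proof -
  obtain C where C: "h i + b i = max C (b i)" "h (i + 1) + b (i + 1) = max C (b (i + 1))"
    using assms(2) unfolding lake_at_rest_def by blast
  have "v i = 0" "v (i + 1) = 0"
    using assms(2) by (auto simp: lake_at_rest_def)
  then have "flux_eps F b h v i = sw_flux (max 0 (C - max (b i) (b (i + 1)))) 0"
    using assms(1) unfolding flux_eps_def consistent_flux_def lake_reconstruction[OF C] by simp
  then show ?thesis
    by (simp add: sw_flux_def vector_2_eq_0_iff)
qed

lemma source_lake_at_rest:
  assumes "lake_at_rest b h v"
  shows "phi_eps_minus g b h i * jump_r_eps b h i = 0"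
    and "phi_eps_plus g b h i * jump_r_eps b h i = 0"
proof -
  obtain C where C: "h i + b i = max C (b i)" "h (i + 1) + b (i + 1) = max C (b (i + 1))"
    using assms unfolding lake_at_rest_def by blast
  have eq: "h_eps_plus b h i = h_eps_minus b h i"
    using lake_reconstruction(1,2)[OF C] by simp
  have "h_eps_minus b h i = 0 \<or>
      h_eps_plus b h i + b_eps_plus b h i = h_eps_minus b h i + b_eps_minus b h i"
    using lake_reconstruction(3,4)[OF C] eq by metis
  then show "phi_eps_minus g b h i * jump_r_eps b h i = 0"
    unfolding phi_eps_minus_def jump_r_eps_def sw_phi_def sw_r_def
    by (auto simp: vec_eq_iff forall_2)
  then show "phi_eps_plus g b h i * jump_r_eps b h i = 0"
    unfolding phi_eps_minus_def phi_eps_plus_def eq .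
qed

lemma hr_rate_lake_at_rest:
  assumes "consistent_flux F" and "lake_at_rest b h v"
  shows "hr_rate g dx F b h v i = 0"
  unfolding hr_rate_def
  by (simp add: flux_eps_lake_at_rest[OF assms] source_lake_at_rest[OF assms(2)])

theorem lemma2:
  fixes g dx :: real and F :: num_flux and b h v :: grid
  assumes "g > 0" and "dx > 0"
    and "consistent_flux F"
    and "\<And>i. h i \<ge> 0"
    and "lake_at_rest b h v"
  shows "(\<forall>i. hr_rate g dx F b h v i = 0) \<and> hr_solution g dx F b (\<lambda>t. h) (\<lambda>t. v)"
  using assms(4) by (simp add: hr_solution_def hr_rate_lake_at_rest[OF assms(3,5)])

end
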